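(* Let $m\colon [0,1]\to[0,1]$ be an increasing bijection, and let $\mathcal{M}_m$ be the class of all Lebesgue measurable coordinate-wise non-decreasing functions $f\colon[0,1]^2\to[0,1]$ such that $m_f(u)\ge 1-m(u)$ for all $u\in[0,1]$, where $m_f$ is the distribution function of $f$. Then for each continuous non-decreasing function $t\colon [0,1]\to[0,1]$ one has $$\inf_{f\in\mathcal{M}_m}\int_0^1 f(t(s),s)\,ds=\int_0^1 m^{-1}(t(s)\cdot s)\,ds.$$
   Context: A function $f\colon[0,1]^2\to\mathbb{R}$ is called coordinate-wise non-decreasing if $x_1\le x_2$ and $y_1\le y_2$ imply $f(x_1,y_1)\le f(x_2,y_2)$. Let $\mu$ denote the two-dimensional Lebesgue measure on $[0,1]^2$. The distribution function of a measurable $f\colon[0,1]^2\to\mathbb{R}$ is $m_f(u)=\mu\{(x,y)\in[0,1]^2\colon |f(x,y)|>u\}$, $u\ge 0$. The function $m^{-1}$ is the inverse of the bijection $m$. *)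

theory Defs
  imports "HOL-Analysis.Analysis"
begin

text \<open>Functions on the unit square are total functions on \<^typ>\<open>real \<times> real\<close>; every notion
  below depends only on their values on the square.\<close>

abbreviation unit_square :: "(real \<times> real) set" where
  "unit_square \<equiv> {0..1} \<times> {0..1}"

definition coordwise_mono :: "(real \<times> real \<Rightarrow> real) \<Rightarrow> bool" where
  "coordwise_mono f \<longleftrightarrow>
     (\<forall>x1\<in>{0..1}. \<forall>x2\<in>{0..1}. \<forall>y1\<in>{0..1}. \<forall>y2\<in>{0..1}.
        x1 \<le> x2 \<longrightarrow> y1 \<le> y2 \<longrightarrow> f (x1, y1) \<le> f (x2, y2))"

definition distr_fun :: "(real \<times> real \<Rightarrow> real) \<Rightarrow> real \<Rightarrow> real" where
  "distr_fun f u = measure lebesgue {z \<in> unit_square. \<bar>f z\<bar> > u}"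

definition class_M :: "(real \<Rightarrow> real) \<Rightarrow> (real \<times> real \<Rightarrow> real) set" where
  "class_M m =
     {f. f \<in> borel_measurable (lebesgue_on unit_square)
         \<and> f \<in> unit_square \<rightarrow> {0..1}
         \<and> coordwise_mono f
         \<and> (\<forall>u\<in>{0..1}. distr_fun f u \<ge> 1 - m u)}"

end

theory Submission
  imports Defs
begin

text \<open>If \<^term>\<open>f (x, y) = v\<close>, monotonicity puts \<^term>\<open>{0..x} \<times> {0..y}\<close> inside the sublevel set
  of \<^term>\<open>f\<close> at \<^term>\<open>v\<close>, whose area is at most \<^term>\<open>m v\<close>; hence \<^term>\<open>f (x, y)\<close> is at least the
  inverse of \<^term>\<open>m\<close> at \<^term>\<open>x * y\<close>. This gives the lower bound pointwise along the curve
  \<open>s \<mapsto> (t s, s)\<close>. The bound is attained: since the curve is monotone, the rectangles spanned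
  by the origin and its points are nested, and there is a monotone function whose sublevel sets are
  exactly such rectangles, each as large as the constraint permits.\<close>

section \<open>Rectangles in the square and monotone integrands\<close>

lemma cbox_prod_real:
  fixes a b c d :: real
  shows "{a..b} \<times> {c..d} = cbox (a, c) (b, d)"
  by (simp add: cbox_Pair_eq)

lemma measure_rectangle:
  fixes a b :: real
  assumes "0 \<le> a" "0 \<le> b"
  shows "measure lebesgue ({0..a} \<times> {0..b}) = a * b"
  using assms by (simp add: cbox_prod_real content_Pair)

lemma rectangle_lmeasurable: "{a..b::real} \<times> {c..d::real} \<in> lmeasurable"
  by (simp add: cbox_prod_real)

lemma measure_square_diff_rectangle:
  assumes "a \<in> {0..1}" "b \<in> {0..1}"
  shows "measure lebesgue (unit_square - {0..a} \<times> {0..b}) = 1 - a * b"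
proof -
  have "measure lebesgue (unit_square - {0..a} \<times> {0..b})
      = measure lebesgue unit_square - measure lebesgue ({0..a} \<times> {0..b})"
    by (rule measurable_measure_Diff)
      (use assms in \<open>auto intro: rectangle_lmeasurable fmeasurableD\<close>)
  then show ?thesis
    using assms measure_rectangle[of a b] measure_rectangle[of 1 1] by simp
qed

text \<open>A monotone function on a compact interval is Borel measurable and bounded by its
  endpoint values. Comparing two integrals requires both integrands to be integrable.\<close>

lemma set_integrable_mono_on:
  fixes h :: "real \<Rightarrow> real"
  assumes "mono_on {a..b} h"
  shows "set_integrable lebesgue {a..b} h"
proof (rule measurable_bounded_by_integrable_imp_absolutely_integrable)
  have "h \<in> borel_measurable (restrict_space borel {a..b})"
    by (rule borel_measurable_mono_on_fnc[OF assms])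
  then have "h \<in> borel_measurable (lebesgue_on {a..b})"
    by (simp add: borel_measurable_restrict_space_iff measurable_completion)
  then show "h \<in> borel_measurable (lebesgue_on {a..b})" .
  show "(\<lambda>_. \<bar>h a\<bar> + \<bar>h b\<bar>) integrable_on {a..b}"
    by (rule integrable_const_ivl)
  fix x assume "x \<in> {a..b}"
  then have "h a \<le> h x" "h x \<le> h b"
    using assms by (auto simp: mono_on_def)
  then show "norm (h x) \<le> \<bar>h a\<bar> + \<bar>h b\<bar>"
    by auto
qed auto

section \<open>The inverse of \<open>m\<close> and the pointwise lower bound\<close>

locale area_bound =
  fixes m :: "real \<Rightarrow> real"
  assumes bij: "bij_betw m {0..1} {0..1}"
    and strict_mono: "strict_mono_on {0..1} m"
begin

abbreviation m_inv :: "real \<Rightarrow> real" where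
  "m_inv \<equiv> inv_into {0..1} m"

lemma m_inv_in: "v \<in> {0..1} \<Longrightarrow> m_inv v \<in> {0..1}"
  using bij by (metis bij_betw_imp_surj_on inv_into_into)

lemma m_m_inv: "v \<in> {0..1} \<Longrightarrow> m (m_inv v) = v"
  using bij by (metis bij_betw_imp_surj_on f_inv_into_f)

lemma m_in: "u \<in> {0..1} \<Longrightarrow> m u \<in> {0..1}"
  using bij by (meson bij_betwE)

text \<open>Strict monotonicity of \<open>m\<close> carries the order across in both directions.
  This adjunction is how values of functions are traded for areas below.\<close>

lemma m_inv_le_iff:
  assumes "u \<in> {0..1}" "v \<in> {0..1}"
  shows "m_inv v \<le> u \<longleftrightarrow> v \<le> m u"
  using strict_mono_on_leD[OF strict_mono m_inv_in[OF assms(2)] assms(1)]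
    strict_mono_onD[OF strict_mono assms(1) m_inv_in[OF assms(2)]]
  by (metis assms(2) linorder_not_le m_m_inv)

lemma m_inv_mono:
  assumes "v \<in> {0..1}" "w \<in> {0..1}" "v \<le> w"
  shows "m_inv v \<le> m_inv w"
  using m_inv_le_iff[OF m_inv_in[OF assms(2)] assms(1)] m_m_inv[OF assms(2)] assms(3) by simp

lemma class_M_ge:
  assumes f: "f \<in> class_M m" and x: "x \<in> {0..1}" and y: "y \<in> {0..1}"
  shows "m_inv (x * y) \<le> f (x, y)"
proof -
  \<comment> \<open>The constraint is tested at the level \<open>f (x, y)\<close> itself: its strict
    superlevel set misses the rectangle below \<open>(x, y)\<close>.\<close>
  have fxy: "f (x, y) \<in> {0..1}" and mono: "coordwise_mono f"
    and meas: "f \<in> borel_measurable (lebesgue_on unit_square)"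
    and distr: "1 - m (f (x, y)) \<le> distr_fun f (f (x, y))"
    using f x y by (auto simp: class_M_def)
  have "{z \<in> unit_square. \<bar>f z\<bar> > f (x, y)} \<subseteq> unit_square - {0..x} \<times> {0..y}"
  proof (intro subsetI)
    fix z assume z: "z \<in> {z \<in> unit_square. \<bar>f z\<bar> > f (x, y)}"
    then have "f z \<in> {0..1}"
      using f by (auto simp: class_M_def)
    with z have less: "f (x, y) < f z"
      by simp
    have "f z \<le> f (x, y)" if "z \<in> {0..x} \<times> {0..y}"
      using mono[unfolded coordwise_mono_def, rule_format, of "fst z" x "snd z" y] that x y z
      by (auto simp: mem_Times_iff)
    then show "z \<in> unit_square - {0..x} \<times> {0..y}"
      using z less by auto
  qed
  moreover have "{z \<in> unit_square. \<bar>f z\<bar> > f (x, y)} \<in> sets lebesgue"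
  proof -
    have "{z \<in> space (lebesgue_on unit_square). f (x, y) < \<bar>f z\<bar>} \<in> sets (lebesgue_on unit_square)"
      using meas by measurable
    then show ?thesis
      by (subst (asm) sets_restrict_space_iff) (auto simp: cbox_prod_real)
  qed
  ultimately have "distr_fun f (f (x, y)) \<le> measure lebesgue (unit_square - {0..x} \<times> {0..y})"
    unfolding distr_fun_def
    by (intro measure_mono_fmeasurable) (auto intro!: fmeasurable.Diff rectangle_lmeasurable)
  then have "x * y \<le> m (f (x, y))"
    using distr measure_square_diff_rectangle[OF x y] by linarith
  moreover have "x * y \<in> {0..1}"
    using x y by (auto intro: mult_le_one)
  ultimately show ?thesis
    using m_inv_le_iff fxy by blast
qed

end

section \<open>The extremal function of a monotone curve\<close>

locale monotone_curve = area_bound +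
  fixes t :: "real \<Rightarrow> real"
  assumes t_in: "t \<in> {0..1} \<rightarrow> {0..1}"
    and t_cont: "continuous_on {0..1} t"
    and t_mono: "mono_on {0..1} t"
begin

definition profile :: "real \<Rightarrow> real" where
  "profile s = m_inv (t s * s)"

definition covering :: "real \<times> real \<Rightarrow> real set" where
  "covering z = {s \<in> {0..1}. fst z \<le> t s \<and> snd z \<le> s}"

text \<open>Since \<open>profile\<close> is monotone and the infimum is attained, this is the least
  \<open>profile s\<close> over the curve points \<open>(t s, s)\<close> that dominate
  \<open>z\<close>. Where no curve point dominates, the largest admissible value 1 preserves
  monotonicity and favours the constraint, which asks for large superlevel sets.\<close>

definition extremal :: "real \<times> real \<Rightarrow> real" where
  "extremal z = (if covering z = {} then 1 else profile (Inf (covering z)))"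

lemma area_in: "s \<in> {0..1} \<Longrightarrow> t s * s \<in> {0..1}"
  using t_in by (auto intro!: mult_le_one simp: Pi_iff)

lemma profile_in: "s \<in> {0..1} \<Longrightarrow> profile s \<in> {0..1}"
  unfolding profile_def by (intro m_inv_in area_in)

lemma area_mono:
  assumes "r \<in> {0..1}" "s \<in> {0..1}" "r \<le> s"
  shows "t r * r \<le> t s * s"
  using assms t_in mono_onD[OF t_mono assms] by (auto intro!: mult_mono simp: Pi_iff)

lemma profile_mono:
  assumes "r \<in> {0..1}" "s \<in> {0..1}" "r \<le> s"
  shows "profile r \<le> profile s"
  unfolding profile_def using assms by (intro m_inv_mono area_in area_mono)

lemma Inf_covering_le: "s \<in> covering z \<Longrightarrow> Inf (covering z) \<le> s"
  by (rule cInf_lower) (auto simp: covering_def intro!: bdd_belowI[of _ 0])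

text \<open>Continuity of \<open>t\<close> makes \<open>covering z\<close> closed, so the infimum is
  attained.\<close>

lemma Inf_covering_in:
  assumes "covering z \<noteq> {}"
  shows "Inf (covering z) \<in> covering z"
proof (rule closed_contains_Inf[OF assms])
  show "bdd_below (covering z)"
    by (auto simp: covering_def intro!: bdd_belowI[of _ 0])
  have "covering z = {s \<in> {0..1}. fst z \<le> t s} \<inter> {snd z..}"
    by (auto simp: covering_def)
  moreover have "closed {s \<in> {0..1}. fst z \<le> t s}"
    by (intro continuous_on_closed_Collect_le t_cont continuous_intros closed_atLeastAtMost)
  ultimately show "closed (covering z)"
    by auto
qed

lemma extremal_le:
  assumes "s \<in> covering z"
  shows "extremal z \<le> profile s"
proof -
  have ne: "covering z \<noteq> {}"
    using assms by blast
  have "profile (Inf (covering z)) \<le> profile s"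
    using assms Inf_covering_in[OF ne] Inf_covering_le[OF assms]
    by (intro profile_mono) (simp_all add: covering_def)
  then show ?thesis
    using ne by (simp add: extremal_def)
qed

lemma extremal_in: "extremal z \<in> {0..1}"
  using Inf_covering_in[of z] profile_in by (auto simp: extremal_def covering_def)

lemma extremal_mono: "coordwise_mono extremal"
  unfolding coordwise_mono_def
proof (intro ballI impI)
  fix x1 x2 y1 y2 :: real
  assume le: "x1 \<le> x2" "y1 \<le> y2"
  show "extremal (x1, y1) \<le> extremal (x2, y2)"
  proof (cases "covering (x2, y2) = {}")
    case True
    then show ?thesis
      using extremal_in by (auto simp: extremal_def)
  next
    case False
    \<comment> \<open>A curve point that dominates the larger point dominates the smaller one
      too.\<close>
    from Inf_covering_in[OF this] have "Inf (covering (x2, y2)) \<in> covering (x1, y1)"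
      using le by (auto simp: covering_def)
    from extremal_le[OF this] show ?thesis
      using False by (simp add: extremal_def)
  qed
qed

text \<open>The upper right corner of the rectangle is the last curve point \<open>(t b, b)\<close>
  whose rectangle has area at most \<open>m u\<close>; it exists because the area
  \<open>t s * s\<close> is continuous in \<open>s\<close>.\<close>

lemma extremal_sublevel:
  assumes u: "0 \<le> u" "u < 1"
  obtains a b where "a \<in> {0..1}" "b \<in> {0..1}" "a * b \<le> m u"
    "{z \<in> unit_square. extremal z \<le> u} = {0..a} \<times> {0..b}"
proof -
  define S where "S = {s \<in> {0..1}. t s * s \<le> m u}"
  define b where "b = Sup S"
  have bdd: "bdd_above S"
    by (auto simp: S_def intro!: bdd_aboveI[of _ 1])
  have "b \<in> S"
    unfolding b_def
  proof (rule closed_contains_Sup[OF _ bdd])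
    have "0 \<in> S"
      using m_in[of u] u by (auto simp: S_def)
    then show "S \<noteq> {}"
      by blast
    show "closed S"
      unfolding S_def by (intro continuous_on_closed_Collect_le t_cont continuous_intros closed_atLeastAtMost)
  qed
  then have b: "b \<in> {0..1}" "t b * b \<le> m u"
    by (auto simp: S_def)
  have "{z \<in> unit_square. extremal z \<le> u} = {0..t b} \<times> {0..b}"
  proof (intro equalityI subsetI)
    fix z assume z: "z \<in> {z \<in> unit_square. extremal z \<le> u}"
    \<comment> \<open>Here \<open>u < 1\<close> excludes the default value 1.\<close>
    then have "covering z \<noteq> {}"
      using u by (auto simp: extremal_def)
    define s where "s = Inf (covering z)"
    have s: "s \<in> covering z"
      unfolding s_def using \<open>covering z \<noteq> {}\<close> by (rule Inf_covering_in)
    have "profile s \<le> u"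
      using z \<open>covering z \<noteq> {}\<close> by (simp add: extremal_def s_def)
    \<comment> \<open>The adjunction turns \<open>profile s \<le> u\<close> into
      \<open>t s * s \<le> m u\<close>.\<close>
    then have "s \<in> S"
      using s u m_inv_le_iff[of u "t s * s"] area_in[of s]
      by (auto simp: S_def profile_def covering_def)
    then have "s \<le> b"
      unfolding b_def using bdd by (rule cSup_upper)
    moreover from this have "t s \<le> t b"
      using t_mono b(1) s by (auto simp: mono_on_def covering_def)
    ultimately show "z \<in> {0..t b} \<times> {0..b}"
      using s z by (auto simp: covering_def mem_Times_iff)
  next
    fix z assume z: "z \<in> {0..t b} \<times> {0..b}"
    then have "b \<in> covering z"
      using b by (auto simp: covering_def)
    then have "extremal z \<le> profile b"
      by (rule extremal_le)
    also have "profile b \<le> u"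
      using b u m_inv_le_iff[of u "t b * b"] area_in[of b] by (simp add: profile_def)
    finally have "extremal z \<le> u" .
    moreover have "t b \<le> 1" "b \<le> 1"
      using b t_in by auto
    ultimately show "z \<in> {z \<in> unit_square. extremal z \<le> u}"
      using z by (auto simp: mem_Times_iff)
  qed
  then show ?thesis
    using that[of "t b" b] b t_in by blast
qed

text \<open>Within the square, every sublevel set is empty, a closed rectangle or the whole
  square.\<close>

lemma extremal_measurable: "extremal \<in> borel_measurable (lebesgue_on unit_square)"
proof (rule borel_measurableI_le)
  fix u :: real
  consider "u < 0" | "0 \<le> u" "u < 1" | "1 \<le> u"
    by linarith
  then have "{z \<in> unit_square. extremal z \<le> u} \<in> sets lebesgue"
  proof cases
    case 1
    then have "u < extremal z" for z
      using extremal_in[of z] by simp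
    then have "{z \<in> unit_square. extremal z \<le> u} = {}"
      by (metis (no_types, lifting) Collect_empty_eq not_le)
    then show ?thesis
      by (simp only: sets.empty_sets)
  next
    case 2
    then obtain a b where "{z \<in> unit_square. extremal z \<le> u} = {0..a} \<times> {0..b}"
      by (rule extremal_sublevel)
    then show ?thesis
      by (simp only: fmeasurableD[OF rectangle_lmeasurable])
  next
    case 3
    then have "extremal z \<le> u" for z
      using extremal_in[of z] by simp
    then have "{z \<in> unit_square. extremal z \<le> u} = unit_square"
      by simp
    then show ?thesis
      by (simp add: rectangle_lmeasurable fmeasurableD)
  qed
  then show "{z \<in> space (lebesgue_on unit_square). extremal z \<le> u} \<in> sets (lebesgue_on unit_square)"
    by (subst sets_restrict_space_iff) (auto simp: cbox_prod_real)
qed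

lemma extremal_distr:
  assumes "u \<in> {0..1}"
  shows "1 - m u \<le> distr_fun extremal u"
proof (cases "u = 1")
  case True
  \<comment> \<open>At level 1 the required lower bound is 0, which any measure satisfies.\<close>
  have "m 1 = 1"
    using m_inv_le_iff[of 1 1] m_inv_in[of 1] m_in[of 1] by auto
  then show ?thesis
    using True by (simp add: distr_fun_def)
next
  case False
  with assms obtain a b where ab: "a \<in> {0..1}" "b \<in> {0..1}" "a * b \<le> m u"
    "{z \<in> unit_square. extremal z \<le> u} = {0..a} \<times> {0..b}"
    by (auto elim: extremal_sublevel[of u])
  have "\<bar>extremal z\<bar> = extremal z" for z
    using extremal_in[of z] by simp
  then have "{z \<in> unit_square. \<bar>extremal z\<bar> > u}
      = unit_square - {z \<in> unit_square. extremal z \<le> u}"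
    by auto
  then show ?thesis
    using ab by (simp add: distr_fun_def measure_square_diff_rectangle)
qed

lemma extremal_in_class: "extremal \<in> class_M m"
  using extremal_measurable extremal_in extremal_mono extremal_distr
  by (auto simp: class_M_def)

section \<open>Integrals along the curve\<close>

lemma class_M_curve_mono:
  assumes "f \<in> class_M m"
  shows "mono_on {0..1} (\<lambda>s. f (t s, s))"
  using assms t_in t_mono
  by (auto simp: class_M_def coordwise_mono_def mono_on_def Pi_iff)

lemma profile_le_class_M:
  assumes "f \<in> class_M m" "s \<in> {0..1}"
  shows "profile s \<le> f (t s, s)"
  unfolding profile_def using assms t_in by (intro class_M_ge) auto

lemma extremal_curve:
  assumes "s \<in> {0..1}"
  shows "extremal (t s, s) = profile s"
proof (rule antisym)
  show "extremal (t s, s) \<le> profile s"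
    by (rule extremal_le) (use assms in \<open>simp add: covering_def\<close>)
  \<comment> \<open>The lower bound valid for the whole class applies to \<open>extremal\<close> as
    a member of it.\<close>
  show "profile s \<le> extremal (t s, s)"
    by (rule profile_le_class_M[OF extremal_in_class assms])
qed

lemma INF_class_M:
  "(INF f\<in>class_M m. LINT s:{0..1}|lebesgue. f (t s, s)) = (LINT s:{0..1}|lebesgue. profile s)"
proof (rule cInf_eq_minimum)
  have "(LINT s:{0..1}|lebesgue. profile s) = (LINT s:{0..1}|lebesgue. extremal (t s, s))"
    by (rule set_lebesgue_integral_cong) (auto simp: extremal_curve)
  then show "(LINT s:{0..1}|lebesgue. profile s)
      \<in> (\<lambda>f. LINT s:{0..1}|lebesgue. f (t s, s)) ` class_M m"
    using extremal_in_class by blast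
next
  fix I assume "I \<in> (\<lambda>f. LINT s:{0..1}|lebesgue. f (t s, s)) ` class_M m"
  then obtain f where f: "f \<in> class_M m" and I: "I = (LINT s:{0..1}|lebesgue. f (t s, s))"
    by blast
  \<comment> \<open>Both integrands are integrable because they are monotone in \<open>s\<close>.
    The curve is a null set of the plane, so measurability of \<open>f\<close> on the square gives
    no information along it.\<close>
  have "mono_on {0..1} profile"
    by (auto simp: mono_on_def intro: profile_mono)
  then show "(LINT s:{0..1}|lebesgue. profile s) \<le> I"
    unfolding I using class_M_curve_mono[OF f] profile_le_class_M[OF f]
    by (intro set_integral_mono set_integrable_mono_on)
qed

end

theorem theorem1:
  fixes m t :: "real \<Rightarrow> real"
  assumes "bij_betw m {0..1} {0..1}"
    and "strict_mono_on {0..1} m"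
    and "t \<in> {0..1} \<rightarrow> {0..1}"
    and "continuous_on {0..1} t"
    and "mono_on {0..1} t"
  shows "(INF f\<in>class_M m. LINT s:{0..1}|lebesgue. f (t s, s))
       = (LINT s:{0..1}|lebesgue. inv_into {0..1} m (t s * s))"
proof -
  interpret monotone_curve m t
    using assms by unfold_locales
  show ?thesis
    using INF_class_M by (simp add: profile_def)
qed

end
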